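(* Let $A\in SL(n,\mathbb{Z})$ be a hyperbolic matrix with irreducible characteristic polynomial $f$ (over $\mathbb{Q}$) and distinct real eigenvalues $\lambda_1,\dots,\lambda_n$. Let $K=\mathbb{Q}(\lambda)$, where $\lambda$ is an eigenvalue of $A$, and suppose that the ring of integers of $K$ is $\mathcal O_K=\mathbb{Z}[\lambda]$. Suppose the number of eigenvalues among $\lambda_1,\dots,\lambda_n$ that belong to $K$ is equal to $r$. If the class number $h(K)>r$, then there exists a matrix $A'\in SL(n,\mathbb{Z})$ having the same eigenvalues as $A$ whose centralizer $Z(A')$ is not conjugate in $GL(n,\mathbb{Z})$ to $Z(A)$. Furthermore, the number of matrices in $SL(n,\mathbb{Z})$ having the same eigenvalues as $A$ with pairwise nonconjugate (in $GL(n,\mathbb{Z})$) centralizers is at least $\left[\frac{h(K)}{r}\right]+1$, where $[x]$ is the largest integer $<x$.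
   Context: A matrix is hyperbolic if none of its eigenvalues has absolute value $1$. For $A\in GL(n,\mathbb{Z})$, $Z(A)$ denotes the centralizer of $A$ in $GL(n,\mathbb{Z})$. "Having the same eigenvalues as $A$" means having the same characteristic polynomial $f$. Note that $[x]$ denotes the largest integer strictly less than $x$. *)

theory Defs
  imports
    "Jordan_Normal_Form.Char_Poly"
    "Jordan_Normal_Form.VS_Connect"
    "HOL-Algebra.Generated_Fields"
    "HOL-Computational_Algebra.Computational_Algebra"
begin

definition GL_int :: "nat \<Rightarrow> int mat set" where
  "GL_int n = {P \<in> carrier_mat n n. invertible_mat P}"

definition SL_int :: "nat \<Rightarrow> int mat set" where
  "SL_int n = {A \<in> carrier_mat n n. det A = 1}"

definition hyperbolic_mat :: "int mat \<Rightarrow> bool" where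
  "hyperbolic_mat A \<longleftrightarrow>
     (\<forall>\<mu>::complex. eigenvalue (map_mat of_int A) \<mu> \<longrightarrow> cmod \<mu> \<noteq> 1)"

definition centralizer_GL :: "nat \<Rightarrow> int mat \<Rightarrow> int mat set" where
  "centralizer_GL n A = {B \<in> GL_int n. A * B = B * A}"

text \<open>Conjugacy of subsets: \<open>H' = P H P\<^sup>-\<^sup>1\<close>, where \<open>Q\<close> plays the role of the inverse of \<open>P\<close>.\<close>

definition conjugate_GL :: "nat \<Rightarrow> int mat set \<Rightarrow> int mat set \<Rightarrow> bool" where
  "conjugate_GL n H H' \<longleftrightarrow>
     (\<exists>P \<in> GL_int n. \<exists>Q \<in> GL_int n. P * Q = 1\<^sub>m n \<and> Q * P = 1\<^sub>m n \<and>
        H' = (\<lambda>B. P * B * Q) ` H)"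

text \<open>In a field of characteristic 0 the subfield generated by \<open>x\<close> is \<open>\<rat>(x)\<close> and the subring
  generated by \<open>x\<close> is \<open>\<int>[x]\<close>. Number fields are represented as subsets of an ambient field.\<close>

definition rat_adjoin :: "'a :: field_char_0 \<Rightarrow> 'a set" where
  "rat_adjoin x = generate_field class_ring {x}"

definition int_adjoin :: "'a :: field_char_0 \<Rightarrow> 'a set" where
  "int_adjoin x = generate_ring class_ring {x}"

definition ring_of_integers :: "'a :: field_char_0 set \<Rightarrow> 'a set" where
  "ring_of_integers K = {x \<in> K. algebraic_int x}"

definition nonzero_ideals :: "'a :: field_char_0 set \<Rightarrow> 'a set set" where
  "nonzero_ideals R = {I. ideal I (class_ring\<lparr>carrier := R\<rparr>) \<and> I \<noteq> {0}}"

text \<open>Ideals \<open>I\<close> and \<open>J\<close> are in the same class iff \<open>aI = bJ\<close> for some nonzero \<open>a, b\<close> in the ring.\<close>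

definition ideal_class_rel :: "'a :: field_char_0 set \<Rightarrow> ('a set \<times> 'a set) set" where
  "ideal_class_rel R =
     {(I, J). I \<in> nonzero_ideals R \<and> J \<in> nonzero_ideals R \<and>
        (\<exists>a \<in> R - {0}. \<exists>b \<in> R - {0}. (*) a ` I = (*) b ` J)}"

definition class_number :: "'a :: field_char_0 set \<Rightarrow> nat" where
  "class_number K =
     card (nonzero_ideals (ring_of_integers K) // ideal_class_rel (ring_of_integers K))"

text \<open>The largest integer strictly less than \<open>x\<close>; this differs from the floor at integers.\<close>

definition strict_floor :: "real \<Rightarrow> int" where
  "strict_floor x = (GREATEST k. of_int k < x)"

lemma strict_floor_eq: "strict_floor x = \<lceil>x\<rceil> - 1"
  unfolding strict_floor_def by (rule Greatest_equality) linarith+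

lemma equiv_ideal_class_rel:
  assumes R: "1 \<in> R" "\<And>x y. x \<in> R \<Longrightarrow> y \<in> R \<Longrightarrow> x * y \<in> R"
  shows "equiv (nonzero_ideals R) (ideal_class_rel R)"
proof (rule equivI)
  show "ideal_class_rel R \<subseteq> nonzero_ideals R \<times> nonzero_ideals R"
    by (auto simp: ideal_class_rel_def)
  show "refl_on (nonzero_ideals R) (ideal_class_rel R)"
    using R(1) by (force simp: refl_on_def ideal_class_rel_def)
  show "sym (ideal_class_rel R)"
    unfolding sym_def ideal_class_rel_def by (blast dest: sym)
  show "trans (ideal_class_rel R)"
  proof (rule transI)
    fix I J L assume "(I, J) \<in> ideal_class_rel R" "(J, L) \<in> ideal_class_rel R"
    then obtain a b c d where *: "I \<in> nonzero_ideals R" "L \<in> nonzero_ideals R"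
      "a \<in> R - {0}" "b \<in> R - {0}" "(*) a ` I = (*) b ` J"
      "c \<in> R - {0}" "d \<in> R - {0}" "(*) c ` J = (*) d ` L"
      by (auto simp: ideal_class_rel_def)
    have m: "(*) (x * y) ` S = (*) x ` (*) y ` S" for x y :: 'a and S
      by (simp add: image_image mult.assoc)
    have "(*) (c * a) ` I = (*) c ` (*) b ` J" by (simp only: m *)
    also have "\<dots> = (*) b ` (*) c ` J" by (simp only: m[symmetric] mult.commute)
    also have "\<dots> = (*) (b * d) ` L" by (simp only: m *)
    finally have "(*) (c * a) ` I = (*) (b * d) ` L" .
    moreover have "c * a \<in> R - {0}" "b * d \<in> R - {0}" using * R(2) by auto
    ultimately show "(I, L) \<in> ideal_class_rel R"
      using *(1,2) unfolding ideal_class_rel_def by blast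
  qed
qed

end

theory Submission
  imports Defs "HOL-Computational_Algebra.Field_as_Ring"
begin

text \<open>
  Every nonzero ideal \<open>I\<close> of \<open>\<int>[\<lambda>]\<close> is the \<open>\<int>\<close>-span of the entries of a vector \<open>v\<close>, and multiplication by
  \<open>\<lambda>\<close> gives an integer matrix \<open>M\<close> with \<open>M v = \<lambda> v\<close>; irreducibility forces its characteristic polynomial
  to be \<open>f\<close>. As eigenspaces are lines, \<open>GL(n, \<int>)\<close>-conjugate matrices come from ideals in the same
  class (the easy half of the Latimer--MacDuffee correspondence). On the other hand, if \<open>Z(M)\<close> is
  conjugate to \<open>Z(C)\<close>, then a conjugate of \<open>M\<close> commutes with \<open>C\<close>, so it acts on the eigenline of \<open>C\<close> by
  a root of \<open>f\<close> in \<open>\<rat>(\<lambda>)\<close>, which determines it. Hence each conjugacy class of centralizers accounts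
  for at most \<open>r\<close> ideal classes.
\<close>

no_notation fps_nth (infixl \<open>$\<close> 75)
hide_const (open) up_ring.coeff up_ring.monom Module.smult

section \<open>Integral spans and simple extensions\<close>

text \<open>A nonzero element \<open>d\<close> of least absolute value divides every other one: the
  remainder \<open>x mod d\<close> is \<open>x\<close> plus a multiple of \<open>d\<close>, so it
  stays in \<open>D\<close>, and being smaller than \<open>d\<close> it vanishes.\<close>

lemma int_module_principal:
  fixes D :: "int set"
  assumes "0 \<in> D" and cl: "\<And>x y k. x \<in> D \<Longrightarrow> y \<in> D \<Longrightarrow> x + k * y \<in> D"
  shows "\<exists>d\<in>D. \<forall>x\<in>D. d dvd x"
proof (cases "D = {0}")
  case False
  with \<open>0 \<in> D\<close> obtain e where "e \<in> D \<and> e \<noteq> 0" by blast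
  then obtain d where d: "d \<in> D" "d \<noteq> 0"
    and least: "\<And>x. x \<in> D \<and> x \<noteq> 0 \<Longrightarrow> nat \<bar>d\<bar> \<le> nat \<bar>x\<bar>"
    using exists_least_lemma[of "\<lambda>m. \<exists>x. (x \<in> D \<and> x \<noteq> 0) \<and> nat \<bar>x\<bar> = m"]
      ex_has_least_nat[of "\<lambda>x. x \<in> D \<and> x \<noteq> 0" e "\<lambda>x. nat \<bar>x\<bar>"] by blast
  have "d dvd x" if "x \<in> D" for x
  proof (rule ccontr)
    assume "\<not> d dvd x"
    then have "x mod d \<noteq> 0" by (simp add: dvd_eq_mod_eq_0)
    moreover have "x mod d \<in> D"
      using cl[OF that d(1), of "- (x div d)"] by (simp add: minus_div_mult_eq_mod)
    ultimately have "nat \<bar>d\<bar> \<le> nat \<bar>x mod d\<bar>" using least by blast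
    then show False using abs_mod_less[OF d(2), of x] by linarith
  qed
  with d(1) show ?thesis by blast
qed simp

text \<open>The Hermite normal form argument: the coefficients at the last generator form a
  principal ideal of \<open>\<int>\<close>.\<close>

lemma int_submodule_generators:
  fixes g :: "nat \<Rightarrow> 'a :: comm_ring_1" and H :: "'a set"
  assumes "0 \<in> H" and "\<And>x y k. x \<in> H \<Longrightarrow> y \<in> H \<Longrightarrow> x + of_int k * y \<in> H"
    and "\<And>x. x \<in> H \<Longrightarrow> \<exists>a. x = (\<Sum>i<n. of_int (a i) * g i)"
  shows "\<exists>b. (\<forall>i<n. b i \<in> H) \<and> (\<forall>x\<in>H. \<exists>a. x = (\<Sum>i<n. of_int (a i) * b i))"
  using assms
proof (induction n arbitrary: H)
  case 0
  then show ?case by auto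
next
  case (Suc n)
  define D where "D = {d. \<exists>a. (\<Sum>i<n. of_int (a i) * g i) + of_int d * g n \<in> H}"
  have "\<exists>d\<in>D. \<forall>x\<in>D. d dvd x"
  proof (rule int_module_principal)
    show "0 \<in> D" using Suc.prems(1) by (auto simp: D_def intro!: exI[of _ "\<lambda>_. 0"])
    fix x y k assume "x \<in> D" "y \<in> D"
    then obtain a b where "(\<Sum>i<n. of_int (a i) * g i) + of_int x * g n \<in> H"
      "(\<Sum>i<n. of_int (b i) * g i) + of_int y * g n \<in> H" by (auto simp: D_def)
    from Suc.prems(2)[OF this, of k]
    have "(\<Sum>i<n. of_int (a i + k * b i) * g i) + of_int (x + k * y) * g n \<in> H"
      by (simp add: algebra_simps sum.distrib sum_distrib_left)
    then show "x + k * y \<in> D" 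
      unfolding D_def by (auto intro!: exI[of _ "\<lambda>i. a i + k * b i"])
  qed
  then obtain d where d: "d \<in> D" and dvd: "\<And>x. x \<in> D \<Longrightarrow> d dvd x" by blast
  then obtain c where c: "(\<Sum>i<n. of_int (c i) * g i) + of_int d * g n \<in> H" (is "?h \<in> H")
    by (auto simp: D_def)
  let ?S = "\<lambda>a. \<Sum>i<n. of_int (a i) * g i"
  \<comment> \<open>The part of \<open>H\<close> that the first \<open>n\<close> generators already
    reach; the induction hypothesis applies to it.\<close>
  define H' where "H' = H \<inter> range ?S"
  have "\<exists>b. (\<forall>i<n. b i \<in> H') \<and> (\<forall>x\<in>H'. \<exists>a. x = (\<Sum>i<n. of_int (a i) * b i))"
  proof (rule Suc.IH)
    show "0 \<in> H'"
      using Suc.prems(1) by (auto simp: H'_def intro!: range_eqI[of _ _ "\<lambda>_. 0"])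
    show "\<exists>a. x = (\<Sum>i<n. of_int (a i) * g i)" if "x \<in> H'" for x using that by (auto simp: H'_def)
    fix x y k assume "x \<in> H'" "y \<in> H'"
    then obtain a b where ab: "x \<in> H" "y \<in> H" "x = (\<Sum>i<n. of_int (a i) * g i)"
      "y = (\<Sum>i<n. of_int (b i) * g i)" by (auto simp: H'_def)
    have "x + of_int k * y = (\<Sum>i<n. of_int (a i + k * b i) * g i)"
      unfolding ab(3,4) by (simp add: algebra_simps sum.distrib sum_distrib_left)
    then have "x + of_int k * y \<in> range ?S"
      by (rule range_eqI[of _ ?S "\<lambda>i. a i + k * b i"])
    then show "x + of_int k * y \<in> H'"
      using Suc.prems(2)[OF ab(1,2)] unfolding H'_def by blast
  qed
  then obtain b where b: "\<And>i. i < n \<Longrightarrow> b i \<in> H'"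
    "\<And>x. x \<in> H' \<Longrightarrow> \<exists>a. x = (\<Sum>i<n. of_int (a i) * b i)" by blast
  \<comment> \<open>The new generator is an element of \<open>H\<close> whose coefficient at
    \<open>g n\<close> is the generator \<open>d\<close> of the ideal \<open>D\<close>.\<close>
  define b' where "b' = b(n := ?h)"
  have "\<forall>i<Suc n. b' i \<in> H"
    using b(1) c by (auto simp: b'_def H'_def less_Suc_eq)
  moreover have "\<exists>a. x = (\<Sum>i<Suc n. of_int (a i) * b' i)" if x: "x \<in> H" for x
  proof -
    obtain a where a: "x = (\<Sum>i<n. of_int (a i) * g i) + of_int (a n) * g n"
      using Suc.prems(3)[OF x] by auto
    then have "a n \<in> D" using x by (auto simp: D_def)
    with dvd obtain q where q: "a n = q * d" by (metis dvdE mult.commute)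
    \<comment> \<open>Subtracting \<open>q\<close> copies of \<open>?h\<close> cancels the
      coefficient at \<open>g n\<close> and leads back to \<open>H'\<close>.\<close>
    have "x + of_int (- q) * ?h = (\<Sum>i<n. of_int (a i - q * c i) * g i)"
      unfolding a q by (simp add: algebra_simps sum_subtractf sum_negf sum_distrib_left)
    then have "x + of_int (- q) * ?h \<in> range ?S"
      by (rule range_eqI[of _ ?S "\<lambda>i. a i - q * c i"])
    then have "x + of_int (- q) * ?h \<in> H'"
      using Suc.prems(2)[OF x c, of "- q"] unfolding H'_def by blast
    then obtain e where "x + of_int (- q) * ?h = (\<Sum>i<n. of_int (e i) * b i)"
      using b(2) by blast
    then have "x = (\<Sum>i<n. of_int (e i) * b i) + of_int q * ?h"
      by (simp add: algebra_simps)
    also have "\<dots> = (\<Sum>i<Suc n. of_int ((e(n := q)) i) * b' i)" by (simp add: b'_def)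
    finally show ?thesis by blast
  qed
  ultimately show ?case by blast
qed

section \<open>Elements of the generated ring, the generated field and their ideals\<close>

text \<open>Values of integer polynomials at \<open>x\<close> are closed under the generating
  operations, and conversely each is built from \<open>x\<close> and integers by Horner's scheme.
  Ring elements can then be handled through polynomials.\<close>

lemma int_adjoin_eq: "int_adjoin x = range (\<lambda>q. poly (map_poly of_int q) x)"
proof
  let ?S = "range (\<lambda>q. poly (map_poly of_int q) x)"
  have "y \<in> ?S" if "y \<in> generate_ring class_ring {x}" for y
    using that
  proof (induction rule: generate_ring.induct)
    case one
    show ?case by (intro range_eqI[of _ _ 1]) simp
  next
    case (incl h)
    then show ?case by (intro range_eqI[of _ _ "[:0, 1:]"]) simp
  next
    case (a_inv h)
    then obtain q where "h = poly (map_poly of_int q) x" by blast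
    then show ?case
      by (intro range_eqI[of _ _ "- q"]) (simp add: class_ring_simps hom_distribs)
  next
    case (eng_add h1 h2)
    then obtain p q where "h1 = poly (map_poly of_int p) x" "h2 = poly (map_poly of_int q) x"
      by blast
    then show ?case
      by (intro range_eqI[of _ _ "p + q"]) (simp add: class_ring_simps hom_distribs)
  next
    case (eng_mult h1 h2)
    then obtain p q where "h1 = poly (map_poly of_int p) x" "h2 = poly (map_poly of_int q) x"
      by blast
    then show ?case
      by (intro range_eqI[of _ _ "p * q"]) (simp add: class_ring_simps hom_distribs)
  qed
  then show "int_adjoin x \<subseteq> ?S" unfolding int_adjoin_def by blast
  show "?S \<subseteq> int_adjoin x"
  proof
    fix y assume "y \<in> ?S"
    then obtain q where y: "y = poly (map_poly of_int q) x" by blast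
    let ?G = "generate_ring class_ring {x}"
    have add: "a + b \<in> ?G" if "a \<in> ?G" "b \<in> ?G" for a b
      using generate_ring.eng_add[OF that] by simp
    have mult: "a * b \<in> ?G" if "a \<in> ?G" "b \<in> ?G" for a b
      using generate_ring.eng_mult[OF that] by simp
    have one: "1 \<in> ?G" using generate_ring.one[of class_ring "{x}"] by simp
    have neg: "- a \<in> ?G" if "a \<in> ?G" for a
      using generate_ring.a_inv[OF that] by (simp add: class_ring_simps)
    have z: "0 \<in> ?G" using add[OF one neg[OF one]] by simp
    have x: "x \<in> ?G" by (simp add: generate_ring.incl)
    have nat: "of_nat k \<in> ?G" for k
      by (induction k) (auto intro: z add one)
    have int: "of_int k \<in> ?G" for k
      by (cases k) (auto intro: nat neg simp del: of_nat_Suc)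
    have "poly (map_poly of_int q) x \<in> ?G"
      by (induction q) (auto intro!: add mult int x z simp: map_poly_pCons)
    then show "y \<in> int_adjoin x" by (simp add: y int_adjoin_def)
  qed
qed

lemma int_adjoin_subset_rat_adjoin: "int_adjoin x \<subseteq> rat_adjoin x"
proof
  fix y assume "y \<in> int_adjoin x"
  then have "y \<in> generate_ring class_ring {x}" by (simp add: int_adjoin_def)
  then show "y \<in> rat_adjoin x"
    unfolding rat_adjoin_def
    proof induction
    case one
    show ?case using generate_field.one[of class_ring "{x}"] by simp
  next
    case (eng_add h1 h2)
    then show ?case using generate_field.eng_add[of h1 class_ring "{x}" h2] by simp
  next
    case (eng_mult h1 h2)
    then show ?case using generate_field.eng_mult[of h1 class_ring "{x}" h2] by simp
  qed (auto intro: generate_field.intros)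
qed

lemma rat_adjoin_mult: "a \<in> rat_adjoin x \<Longrightarrow> b \<in> rat_adjoin x \<Longrightarrow> a * b \<in> rat_adjoin x"
  using generate_field.eng_mult[of a class_ring "{x}" b] by (simp add: rat_adjoin_def)

lemma rat_adjoin_inverse:
  assumes "a \<in> rat_adjoin x"
  shows "inverse a \<in> rat_adjoin x"
proof (cases "a = 0")
  case False
  have "inv\<^bsub>class_ring\<^esub> a = inverse a"
    unfolding m_inv_def
    by (rule the_equality) (use False in \<open>auto simp: field_simps\<close>)
  with False show ?thesis
    using assms generate_field.m_inv[of a class_ring "{x}"] by (simp add: rat_adjoin_def)
qed (use assms in simp)

lemma sum_int_adjoin:
  assumes "\<And>j. j \<in> S \<Longrightarrow> g j \<in> int_adjoin l"
  shows "(\<Sum>j\<in>S. of_int (c j) * g j) \<in> int_adjoin l"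
proof -
  have "\<forall>j\<in>S. \<exists>q. g j = poly (map_poly of_int q) l" using assms by (auto simp: int_adjoin_eq)
  then obtain q where "\<And>j. j \<in> S \<Longrightarrow> g j = poly (map_poly of_int (q j)) l" by metis
  then have "(\<Sum>j\<in>S. of_int (c j) * g j) = poly (map_poly of_int (\<Sum>j\<in>S. smult (c j) (q j))) l"
    by (simp add: hom_distribs poly_sum)
  then show ?thesis unfolding int_adjoin_eq by blast
qed

lemma of_int_in_int_adjoin: "of_int k \<in> int_adjoin l"
  unfolding int_adjoin_eq by (rule range_eqI[of _ _ "[:k:]"]) (cases "k = 0"; simp)

lemma generator_in_int_adjoin: "l \<in> int_adjoin l"
  unfolding int_adjoin_eq by (rule range_eqI[of _ _ "[:0, 1:]"]) simp

lemma nonzero_idealsD: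
  assumes "I \<in> nonzero_ideals R"
  shows "0 \<in> I" and "I \<subseteq> R" and "\<exists>x\<in>I. x \<noteq> 0"
    and "\<And>x y. x \<in> I \<Longrightarrow> y \<in> I \<Longrightarrow> x + y \<in> I"
    and "\<And>a x. a \<in> R \<Longrightarrow> x \<in> I \<Longrightarrow> a * x \<in> I"
proof -
  interpret ideal I "class_ring\<lparr>carrier := R\<rparr>" using assms by (simp add: nonzero_ideals_def)
  show z: "0 \<in> I" 
    using additive_subgroup.zero_closed[OF is_additive_subgroup] by simp
  show "I \<subseteq> R" using a_subset by simp
  show "\<exists>x\<in>I. x \<noteq> 0" using assms z by (auto simp: nonzero_ideals_def)
  show "x + y \<in> I" if "x \<in> I" "y \<in> I" for x y 
    using additive_subgroup.a_closed[OF is_additive_subgroup that] by simp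
  show "a * x \<in> I" if "a \<in> R" "x \<in> I" for a x using I_l_closed[of x a] that by simp
qed

section \<open>Matrices with a given irreducible characteristic polynomial\<close>

text \<open>\<open>f\<close> is the minimal polynomial of \<open>l\<close>. Irreducibility is taken
  over the rationals, where Bezout's identity is available; integer coefficients together with
  monicity allow division by \<open>f\<close> over the integers.\<close>

locale irreducible_monic_root =
  fixes f :: "int poly" and l :: "'a :: field_char_0"
  assumes irreducible: "irreducible (map_poly rat_of_int f)"
    and monic: "lead_coeff f = 1"
    and root: "poly (map_poly of_int f) l = 0"
begin

text \<open>Otherwise \<open>f\<close> and \<open>g\<close> are coprime over the rationals, and a
  Bezout identity evaluated at the common root \<open>l\<close> reads 0 = 1.\<close>

lemma dvd_of_root:
  assumes "poly (map_poly of_int g) l = 0"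
  shows "map_poly rat_of_int f dvd map_poly rat_of_int g"
proof (rule ccontr)
  let ?F = "map_poly rat_of_int f" and ?G = "map_poly rat_of_int g"
  have eval: "poly (map_poly of_rat (map_poly rat_of_int h)) l = poly (map_poly of_int h) l" for h
    by (simp add: map_poly_map_poly o_def)
  interpret of_rat_poly: map_poly_comm_ring_hom "of_rat :: rat \<Rightarrow> 'a" ..
  assume "\<not> ?F dvd ?G"
  then have "coprime ?F ?G"
    by (rule prime_elem_imp_coprime[OF irreducible_imp_prime_elem[OF irreducible]])
  then have "fst (bezout_coefficients ?F ?G) * ?F + snd (bezout_coefficients ?F ?G) * ?G = 1"
    by (simp add: bezout_coefficients_fst_snd)
  then have "poly (map_poly of_rat (fst (bezout_coefficients ?F ?G) * ?F
      + snd (bezout_coefficients ?F ?G) * ?G)) l = poly (map_poly of_rat 1) l"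
    by simp
  then show False
    using assms root by (simp add: eval of_rat_poly.hom_mult hom_distribs)
qed

lemma eq_0_of_root:
  assumes "poly (map_poly of_int g) l = 0" and "degree g < degree f"
  shows "g = 0"
proof (rule ccontr)
  assume "g \<noteq> 0"
  then have "degree (map_poly rat_of_int f) \<le> degree (map_poly rat_of_int g)"
    by (intro dvd_imp_degree_le dvd_of_root assms) simp
  with assms(2) show False by simp
qed

text \<open>The leading terms cancel in \<open>g - f\<close>, which still vanishes at
  \<open>l\<close> but is now too small in degree to be nonzero.\<close>

lemma eq_of_root:
  assumes "poly (map_poly of_int g) l = 0" and "lead_coeff g = 1" and "degree g = degree f"
  shows "g = f"
proof -
  have "degree (g - f) < degree f \<or> g - f = 0"
  proof (cases "degree f = 0")
    case True
    then show ?thesis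
      using assms monic by (auto elim!: degree_eq_zeroE)
  next
    case False
    have "coeff (g - f) (degree f) = 0" using assms monic by simp
    moreover have "degree (g - f) \<le> degree f" using assms(3) by (intro degree_diff_le) auto
    ultimately show ?thesis
      by (metis leading_coeff_0_iff le_neq_implies_less)
  qed
  moreover have "poly (map_poly of_int (g - f)) l = 0"
    using assms(1) root by (simp add: hom_distribs)
  ultimately have "g - f = 0" using eq_0_of_root by blast
  then show ?thesis by simp
qed

text \<open>Characteristic polynomials are monic of the size of the matrix, so one eigenvalue
  \<open>l\<close> already identifies this one.\<close>

lemma char_poly_eqI:
  assumes M: "M \<in> carrier_mat (degree f) (degree f)"
    and "eigenvalue (map_mat of_int M) l"
  shows "char_poly M = f"
proof (rule eq_of_root)
  show "poly (map_poly of_int (char_poly M)) l = 0"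
    using assms eigenvalue_root_char_poly[of "map_mat of_int M" "degree f" l]
    by (simp add: of_int_hom.char_poly_hom[OF M])
qed (use degree_monic_char_poly[OF M] in auto)

abbreviation powers :: "'a vec" where
  "powers \<equiv> vec (degree f) (\<lambda>k. l ^ k)"

text \<open>A relation among the powers is an integer polynomial of degree below
  \<open>degree f\<close> that vanishes at \<open>l\<close>.\<close>

lemma powers_independent:
  assumes c: "c \<in> carrier_vec (degree f)" and "map_vec of_int c \<bullet> powers = 0"
  shows "c = 0\<^sub>v (degree f)"
proof -
  let ?g = "\<Sum>k<degree f. monom (c $ k) k"
  have coeff: "coeff ?g i = (if i < degree f then c $ i else 0)" for i
    by (simp add: coeff_sum coeff_monom if_distrib[of "\<lambda>m. _ = m"] sum.delta)
  have "poly (map_poly of_int ?g) l = map_vec of_int c \<bullet> powers"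
    using c by (simp add: hom_distribs poly_sum poly_monom scalar_prod_def atLeast0LessThan
        of_int_hom.map_poly_hom_monom)
  moreover have "?g = 0 \<or> degree ?g < degree f"
    by (metis coeff leading_coeff_0_iff)
  ultimately have "?g = 0" using eq_0_of_root[of ?g] assms(2) by metis
  then have "c $ i = 0" if "i < degree f" for i
    using coeff[of i] that by simp
  with c show ?thesis by (intro eq_vecI) auto
qed

lemma int_adjoin_powers:
  assumes "x \<in> int_adjoin l"
  obtains c where "c \<in> carrier_vec (degree f)" and "x = map_vec of_int c \<bullet> powers"
proof -
  obtain q where x: "x = poly (map_poly of_int q) l" using assms by (auto simp: int_adjoin_eq)
  have f0: "f \<noteq> 0" using monic by auto
  define s where "s = pseudo_mod q f"
  \<comment> \<open>As \<open>f\<close> is monic, pseudo-division multiplies \<open>q\<close> by 1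
    only and is an honest division over the integers.\<close>
  obtain u where div: "q = f * u + s"
    using pseudo_divmod(1)[OF f0 surjective_pairing, of q] monic by (simp add: s_def pseudo_mod_def)
  have x': "x = poly (map_poly of_int s) l"
    unfolding x div using root by (simp add: hom_distribs)
  have deg: "s = 0 \<or> degree s < degree f" using pseudo_mod(2)[OF f0] by (simp add: s_def)
  show ?thesis
  proof
    show "vec (degree f) (coeff s) \<in> carrier_vec (degree f)" by simp
    have "x = (\<Sum>k\<le>degree s. of_int (coeff s k) * l ^ k)"
      by (simp add: x' poly_altdef)
    also have "\<dots> = (\<Sum>k<degree f. of_int (coeff s k) * l ^ k)"
      by (rule sum.mono_neutral_cong) (use deg in \<open>auto simp: coeff_eq_0\<close>)
    finally show "x = map_vec of_int (vec (degree f) (coeff s)) \<bullet> powers"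
      by (simp add: scalar_prod_def atLeast0LessThan)
  qed
qed

end

section \<open>Integer spans of the entries of a vector and their base changes\<close>

text \<open>Coefficients are collected in an integer vector, so that an integer matrix applied to
  \<open>v\<close> acts on them by its transpose.\<close>

definition zspan :: "'a :: comm_ring_1 vec \<Rightarrow> 'a set" where
  "zspan v = {map_vec of_int c \<bullet> v |c. c \<in> carrier_vec (dim_vec v)}"

lemma zspan_smult: "zspan (a \<cdot>\<^sub>v v) = (*) a ` zspan v"
proof -
  have "map_vec of_int c \<bullet> (a \<cdot>\<^sub>v v) = a * (map_vec of_int c \<bullet> v)" if "c \<in> carrier_vec (dim_vec v)" for c
    by (rule scalar_prod_smult_right[symmetric, symmetric]) (use that in auto)
  then show ?thesis unfolding zspan_def image_Collect by force
qed

lemma scalar_prod_mult_mat_vec: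
  fixes v :: "'a :: comm_ring_1 vec"
  assumes P: "P \<in> carrier_mat m n" and c: "c \<in> carrier_vec m" and v: "v \<in> carrier_vec n"
  shows "map_vec of_int c \<bullet> (map_mat of_int P *\<^sub>v v) = map_vec of_int (transpose_mat P *\<^sub>v c) \<bullet> v"
proof -
  have "map_vec of_int (transpose_mat P *\<^sub>v c) =
      transpose_mat (map_mat of_int P) *\<^sub>v (map_vec of_int c :: 'a vec)"
    using of_int_hom.mult_mat_vec_hom[of "transpose_mat P" n m c] P c
    by (simp add: map_mat_transpose)
  then show ?thesis
    using transpose_vec_mult_scalar[of "map_mat of_int P" m n v "map_vec of_int c"] P c v by simp
qed

lemma zspan_mult_mat_vec_subset:
  assumes P: "P \<in> carrier_mat n n" and v: "v \<in> carrier_vec n"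
  shows "zspan (map_mat of_int P *\<^sub>v v) \<subseteq> zspan v"
proof
  fix x assume "x \<in> zspan (map_mat of_int P *\<^sub>v v)"
  then obtain c where c: "c \<in> carrier_vec n" "x = map_vec of_int c \<bullet> (map_mat of_int P *\<^sub>v v)"
    using P by (auto simp: zspan_def)
  then have "x = map_vec of_int (transpose_mat P *\<^sub>v c) \<bullet> v"
    using scalar_prod_mult_mat_vec[OF P _ v] by simp
  moreover have "transpose_mat P *\<^sub>v c \<in> carrier_vec (dim_vec v)" using P c v by auto
  ultimately show "x \<in> zspan v" unfolding zspan_def by blast
qed

text \<open>An integer matrix can only shrink the span; applying this to \<open>P\<close> and then
  to its inverse \<open>Q\<close> gives equality.\<close>

lemma zspan_mult_mat_vec:
  assumes P: "P \<in> carrier_mat n n" and Q: "Q \<in> carrier_mat n n" and "Q * P = 1\<^sub>m n"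
    and v: "v \<in> carrier_vec n"
  shows "zspan (map_mat of_int P *\<^sub>v v) = zspan v"
proof
  show "zspan (map_mat of_int P *\<^sub>v v) \<subseteq> zspan v" using P v by (rule zspan_mult_mat_vec_subset)
  have "v = map_mat of_int (Q * P) *\<^sub>v v"
    using assms by (simp add: of_int_hom.mat_hom_one)
  also have "\<dots> = map_mat of_int Q *\<^sub>v (map_mat of_int P *\<^sub>v v)"
    using P Q v by (simp add: of_int_hom.mat_hom_mult[OF Q P])
  finally show "zspan v \<subseteq> zspan (map_mat of_int P *\<^sub>v v)"
    using zspan_mult_mat_vec_subset[OF Q, of "map_mat of_int P *\<^sub>v v"] P v by auto
qed

context irreducible_monic_root
begin

text \<open>Pairing the powers of \<open>M\<close> with a coordinate on which some eigenvector does not vanish gives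
  an integer matrix \<open>T\<close> that maps every eigenvector to a multiple of \<open>(1, l, l\<^sup>2, \<dots>)\<close>. It is
  nonsingular because the powers of \<open>l\<close> are independent.\<close>

lemma eigenline:
  assumes M: "M \<in> carrier_mat (degree f) (degree f)" and char: "char_poly M = f"
  obtains v where "v \<in> carrier_vec (degree f)" and "v \<noteq> 0\<^sub>v (degree f)"
    and "map_mat of_int M *\<^sub>v v = l \<cdot>\<^sub>v v"
    and "\<And>i. i < degree f \<Longrightarrow> v $ i \<in> int_adjoin l"
    and "\<And>w. w \<in> carrier_vec (degree f) \<Longrightarrow> map_mat of_int M *\<^sub>v w = l \<cdot>\<^sub>v w \<Longrightarrow> \<exists>a. w = a \<cdot>\<^sub>v v"
    and "\<And>c. c \<in> carrier_vec (degree f) \<Longrightarrow> map_vec of_int c \<bullet> v = 0 \<Longrightarrow> c = 0\<^sub>v (degree f)"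
proof -
  let ?n = "degree f"
  let ?M = "map_mat of_int M :: 'a mat"
  have M': "?M \<in> carrier_mat ?n ?n" using M by simp
  have "eigenvalue ?M l"
    using root eigenvalue_root_char_poly[OF M'] by (simp add: of_int_hom.char_poly_hom[OF M] char)
  then obtain w0 where w0: "w0 \<in> carrier_vec ?n" "w0 \<noteq> 0\<^sub>v ?n" "?M *\<^sub>v w0 = l \<cdot>\<^sub>v w0"
    using M by (auto simp: eigenvalue_def eigenvector_def)
  then obtain i where i: "i < ?n" "w0 $ i \<noteq> 0" by (metis eq_vecI carrier_vecD index_zero_vec)
  define T where "T = mat ?n ?n (\<lambda>(k, j). (M ^\<^sub>m k) $$ (i, j))"
  let ?T = "map_mat of_int T :: 'a mat"
  have T: "T \<in> carrier_mat ?n ?n" by (simp add: T_def)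
  then have T': "?T \<in> carrier_mat ?n ?n" by simp
  \<comment> \<open>Row \<open>k\<close> of \<open>T\<close> is row \<open>i\<close> of the
    \<open>k\<close>-th power of \<open>M\<close>, which multiplies \<open>w\<close> by
    \<open>l ^ k\<close>.\<close>
  have T_eigen: "?T *\<^sub>v w = w $ i \<cdot>\<^sub>v powers"
    if w: "w \<in> carrier_vec ?n" "?M *\<^sub>v w = l \<cdot>\<^sub>v w" for w
  proof (cases "w = 0\<^sub>v ?n")
    case True
    then show ?thesis using T' i by (intro eq_vecI) auto
  next
    case False
    with w M have ev: "eigenvector ?M w l" by (simp add: eigenvector_def)
    show ?thesis
    proof (rule eq_vecI)
      fix k assume k: "k < dim_vec (w $ i \<cdot>\<^sub>v powers)"
      have pow: "map_mat of_int (M ^\<^sub>m k) = ?M ^\<^sub>m k" by (rule of_int_hom.mat_hom_pow[OF M])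
      have "row ?T k = row (?M ^\<^sub>m k) i"
        unfolding pow[symmetric] 
        using k i carrier_matD[OF M] by (intro eq_vecI) (auto simp: T_def split: if_splits)
      then have "(?T *\<^sub>v w) $ k = (?M ^\<^sub>m k *\<^sub>v w) $ i"
        using k i M T by simp
      also have "\<dots> = (w $ i \<cdot>\<^sub>v powers) $ k"
        unfolding eigenvector_pow[OF M' ev] using k i w(1) by simp
      finally show "(?T *\<^sub>v w) $ k = (w $ i \<cdot>\<^sub>v powers) $ k" .
    qed (use T in simp)
  qed
  \<comment> \<open>A nonzero integer vector killed by the transpose of \<open>T\<close>, paired
    with \<open>?T *\<^sub>v w0\<close>, would give a relation among the powers of
    \<open>l\<close>.\<close>
  have det: "det T \<noteq> 0"
  proof
    assume "det T = 0"
    then have "det (transpose_mat T) = 0" using T by (simp add: det_transpose)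
    then obtain c where c: "c \<in> carrier_vec ?n" "c \<noteq> 0\<^sub>v ?n" "transpose_mat T *\<^sub>v c = 0\<^sub>v ?n"
      using det_0_iff_vec_prod_zero[of "transpose_mat T" ?n] T by auto
    have "w0 $ i * (map_vec of_int c \<bullet> powers) = map_vec of_int c \<bullet> (?T *\<^sub>v w0)"
      using c by (simp add: T_eigen[OF w0(1,3)])
    also have "\<dots> = 0"
      using scalar_prod_mult_mat_vec[OF T c(1) w0(1)] c w0 by (simp add: of_int_hom.vec_hom_zero)
    finally have "map_vec of_int c \<bullet> powers = 0" using i by simp
    with c powers_independent show False by blast
  qed
  \<comment> \<open>The adjugate replaces the inverse of \<open>T\<close>: its entries are integers,
    so the eigenvector \<open>v\<close> has its entries in \<open>int_adjoin l\<close>.\<close>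
  let ?adj = "map_mat of_int (adj_mat T) :: 'a mat"
  have adj: "adj_mat T \<in> carrier_mat ?n ?n" "adj_mat T * T = det T \<cdot>\<^sub>m 1\<^sub>m ?n"
    using adj_mat[OF T] by auto
  define v where "v = ?adj *\<^sub>v powers"
  have v: "v \<in> carrier_vec ?n" unfolding v_def using adj(1) by simp
  have multiple: "of_int (det T) \<cdot>\<^sub>v w = w $ i \<cdot>\<^sub>v v"
    if w: "w \<in> carrier_vec ?n" "?M *\<^sub>v w = l \<cdot>\<^sub>v w" for w
  proof -
    have "?adj *\<^sub>v (?T *\<^sub>v w) = map_mat of_int (adj_mat T * T) *\<^sub>v w"
      using adj(1) T w by (simp add: of_int_hom.mat_hom_mult[OF adj(1) T])
    also have "map_mat of_int (adj_mat T * T) = of_int (det T) \<cdot>\<^sub>m 1\<^sub>m ?n"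
      unfolding adj by (intro eq_matI) auto
    also have "\<dots> *\<^sub>v w = of_int (det T) \<cdot>\<^sub>v w"
      using w by (intro eq_vecI) auto
    finally show ?thesis
      using adj(1) by (simp add: T_eigen[OF w] v_def mult_mat_vec[of _ ?n ?n])
  qed
  have v_eq: "v = (of_int (det T) / w0 $ i) \<cdot>\<^sub>v w0"
    using multiple[OF w0(1,3)] i v w0(1) by (auto simp: vec_eq_iff field_simps)
  show ?thesis
  proof
    show "v \<in> carrier_vec ?n" by fact
    show "v \<noteq> 0\<^sub>v ?n"
    proof
      assume "v = 0\<^sub>v ?n"
      then have "v $ i = 0" using i by simp
      then show False using v_eq det i w0(1) by simp
    qed
    show "?M *\<^sub>v v = l \<cdot>\<^sub>v v"
      unfolding v_eq using w0 M' by (simp add: mult_mat_vec[OF M' w0(1)] smult_smult_assoc mult.commute)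
    show "v $ j \<in> int_adjoin l" if j: "j < ?n" for j
    proof -
      let ?q = "\<Sum>k<?n. monom (adj_mat T $$ (j, k)) k"
      have "v $ j = poly (map_poly of_int ?q) l"
        using j adj(1) by (simp add: v_def scalar_prod_def atLeast0LessThan hom_distribs poly_sum
            poly_monom of_int_hom.map_poly_hom_monom)
      then show ?thesis unfolding int_adjoin_eq by blast
    qed
    show "\<exists>a. w = a \<cdot>\<^sub>v v" if w: "w \<in> carrier_vec ?n" "?M *\<^sub>v w = l \<cdot>\<^sub>v w" for w
    proof
      show "w = (w $ i / of_int (det T)) \<cdot>\<^sub>v v"
        using multiple[OF w] v w(1) det by (auto simp: vec_eq_iff field_simps)
    qed
    show "c = 0\<^sub>v ?n" if c: "c \<in> carrier_vec ?n" and "map_vec of_int c \<bullet> v = 0" for c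
    proof -
      \<comment> \<open>A relation \<open>c\<close> among the entries of \<open>v\<close> becomes
        the relation \<open>?d\<close> among the powers, hence \<open>?d\<close> is zero;
        multiplying by the transpose of \<open>T\<close> recovers \<open>det T\<close> times
        \<open>c\<close>.\<close>
      let ?d = "transpose_mat (adj_mat T) *\<^sub>v c"
      have "map_vec of_int ?d \<bullet> powers = 0"
        using that(2) scalar_prod_mult_mat_vec[OF adj(1) c, of powers] by (simp add: v_def)
      then have "?d = 0\<^sub>v ?n" using adj(1) c by (intro powers_independent) auto
      then have "0\<^sub>v ?n = transpose_mat T *\<^sub>v ?d" using T by auto
      also have "\<dots> = transpose_mat (adj_mat T * T) *\<^sub>v c"
        using T adj(1) c by (simp add: transpose_mult[OF adj(1) T])
      also have "transpose_mat (adj_mat T * T) = det T \<cdot>\<^sub>m 1\<^sub>m ?n"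
        unfolding adj by (intro eq_matI) auto
      also have "\<dots> *\<^sub>v c = det T \<cdot>\<^sub>v c"
        using c by (intro eq_vecI) auto
      finally have "det T \<cdot>\<^sub>v c = 0\<^sub>v ?n" by simp
      with det c show ?thesis by (auto simp: vec_eq_iff)
    qed
  qed
qed

end

section \<open>Ideal classes and conjugacy classes\<close>

context irreducible_monic_root
begin

text \<open>The ideal lies in the span of the first \<open>degree f\<close> powers of
  \<open>l\<close>, so it has that many generators over the integers. It is stable under
  \<open>l\<close>, and row \<open>i\<close> of \<open>M\<close> expresses \<open>l * b i\<close> in
  these generators.\<close>

lemma ideal_matrix:
  assumes I: "I \<in> nonzero_ideals (int_adjoin l)"
  obtains M v where "M \<in> carrier_mat (degree f) (degree f)" and "char_poly M = f"
    and "v \<in> carrier_vec (degree f)" and "v \<noteq> 0\<^sub>v (degree f)"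
    and "map_mat of_int M *\<^sub>v v = l \<cdot>\<^sub>v v" and "zspan v = I"
proof -
  let ?n = "degree f"
  note I' = nonzero_idealsD[OF I]
  have "\<exists>b. (\<forall>i<?n. b i \<in> I) \<and> (\<forall>x\<in>I. \<exists>a. x = (\<Sum>i<?n. of_int (a i) * b i))"
  proof (rule int_submodule_generators)
    show "0 \<in> I" by (rule I'(1))
    show "x + of_int k * y \<in> I" if "x \<in> I" "y \<in> I" for x y k
      using that by (intro I'(4,5) of_int_in_int_adjoin)
    show "\<exists>a. x = (\<Sum>i<?n. of_int (a i) * l ^ i)" if x: "x \<in> I" for x
    proof -
      obtain c where "c \<in> carrier_vec ?n" "x = map_vec of_int c \<bullet> powers"
        using x I'(2) int_adjoin_powers by blast
      then show ?thesis
        by (intro exI[of _ "\<lambda>i. c $ i"]) (auto simp: scalar_prod_def atLeast0LessThan)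
    qed
  qed
  then obtain b where b: "\<And>i. i < ?n \<Longrightarrow> b i \<in> I"
    and gen: "\<And>x. x \<in> I \<Longrightarrow> \<exists>a. x = (\<Sum>i<?n. of_int (a i) * b i)"
    by blast
  define v where "v = vec ?n b"
  have prod: "map_vec of_int c \<bullet> v = (\<Sum>i<?n. of_int (c $ i) * b i)" if "c \<in> carrier_vec ?n" for c
    using that by (auto simp: v_def scalar_prod_def atLeast0LessThan)
  have span: "zspan v = I"
  proof
    have "(\<Sum>i\<in>S. of_int (c $ i) * b i) \<in> I" if "finite S" "S \<subseteq> {..<?n}" for S c
      using that by (induction rule: finite_induct) (auto intro: I' b of_int_in_int_adjoin)
    then show "zspan v \<subseteq> I" by (auto simp: zspan_def prod v_def[THEN arg_cong, of dim_vec])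
    show "I \<subseteq> zspan v"
    proof
      fix x assume "x \<in> I"
      then obtain a where "x = (\<Sum>i<?n. of_int (a i) * b i)" using gen by blast
      then have "x = map_vec of_int (vec ?n a) \<bullet> v" using prod[of "vec ?n a"] by simp
      then show "x \<in> zspan v" unfolding zspan_def by (auto simp: v_def)
    qed
  qed
  have "\<forall>i<?n. \<exists>a. l * b i = (\<Sum>j<?n. of_int (a j) * b j)"
    using b gen I'(5) generator_in_int_adjoin by blast
  then obtain a where a: "\<And>i. i < ?n \<Longrightarrow> l * b i = (\<Sum>j<?n. of_int (a i j) * b j)"
    by metis
  define M where "M = mat ?n ?n (\<lambda>(i, j). a i j)"
  have M: "M \<in> carrier_mat ?n ?n" by (simp add: M_def)
  have v: "v \<in> carrier_vec ?n" by (simp add: v_def)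
  have eq: "map_mat of_int M *\<^sub>v v = l \<cdot>\<^sub>v v"
    by (rule eq_vecI) (auto simp: M_def v_def a scalar_prod_def atLeast0LessThan)
  have nz: "v \<noteq> 0\<^sub>v ?n"
  proof
    assume "v = 0\<^sub>v ?n"
    then have "zspan v \<subseteq> {0}" by (auto simp: zspan_def)
    with span I'(3) show False by blast
  qed
  have "eigenvalue (map_mat of_int M) l"
    using M v eq nz by (auto simp: eigenvalue_def eigenvector_def)
  with M have "char_poly M = f" by (rule char_poly_eqI)
  with M v nz eq span show ?thesis using that by blast
qed

text \<open>The base change \<open>P\<close> carries \<open>v\<close> to an
  \<open>l\<close>-eigenvector of \<open>N\<close>, which is proportional to \<open>w\<close>
  because the eigenspace is a line. Unimodular base change keeps the span \<open>I\<close>, so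
  \<open>I\<close> is a scalar multiple of \<open>J\<close>.\<close>

lemma ideal_class_of_conjugate:
  assumes I: "I \<in> nonzero_ideals (int_adjoin l)" and J: "J \<in> nonzero_ideals (int_adjoin l)"
    and M: "M \<in> carrier_mat (degree f) (degree f)"
    and v: "v \<in> carrier_vec (degree f)" "map_mat of_int M *\<^sub>v v = l \<cdot>\<^sub>v v" "zspan v = I"
    and N: "N \<in> carrier_mat (degree f) (degree f)" "char_poly N = f"
    and w: "w \<in> carrier_vec (degree f)" "w \<noteq> 0\<^sub>v (degree f)" "map_mat of_int N *\<^sub>v w = l \<cdot>\<^sub>v w"
      "zspan w = J"
    and P: "P \<in> carrier_mat (degree f) (degree f)" and Q: "Q \<in> carrier_mat (degree f) (degree f)"
    and QP: "Q * P = 1\<^sub>m (degree f)" and conj: "N = P * M * Q"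
  shows "(I, J) \<in> ideal_class_rel (int_adjoin l)"
proof -
  let ?n = "degree f"
  let ?u = "map_mat of_int P *\<^sub>v v"
  obtain e where e: "e \<in> carrier_vec ?n"
    and line: "\<And>x. x \<in> carrier_vec ?n \<Longrightarrow> map_mat of_int N *\<^sub>v x = l \<cdot>\<^sub>v x \<Longrightarrow> \<exists>a. x = a \<cdot>\<^sub>v e"
    using eigenline[OF N] by metis
  have NP: "N * P = P * M"
    unfolding conj using assoc_mult_mat[of "P * M" ?n ?n Q ?n P ?n] P Q M QP by auto
  have "map_mat of_int N *\<^sub>v ?u = map_mat of_int (N * P) *\<^sub>v v"
    using N P v by (simp add: of_int_hom.mat_hom_mult[OF N(1) P])
  also have "\<dots> = l \<cdot>\<^sub>v ?u"
    unfolding NP using M P v by (simp add: of_int_hom.mat_hom_mult[OF P M] mult_mat_vec[of _ ?n ?n])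
  finally obtain a where a: "?u = a \<cdot>\<^sub>v e" using line[of ?u] P v by auto
  obtain b where b: "w = b \<cdot>\<^sub>v e" using line w by blast
  with w e have "b \<noteq> 0" by auto
  then have "?u = (a / b) \<cdot>\<^sub>v w" unfolding a b by (simp add: smult_smult_assoc)
  then have IJ: "I = (*) (a / b) ` J"
    using zspan_mult_mat_vec[OF P Q QP v(1)] v w zspan_smult by metis
  \<comment> \<open>Clears the denominator of \<open>a / b\<close>: both \<open>y\<close> and
    \<open>a / b * y\<close> lie in the ring, since they belong to \<open>J\<close> and to
    \<open>I\<close>.\<close>
  obtain y where y: "y \<in> J" "y \<noteq> 0" using nonzero_idealsD(3)[OF J] by blast
  have "a / b \<noteq> 0"
    using IJ nonzero_idealsD(3)[OF I] by force
  then have "a / b * y \<in> I" "a / b * y \<noteq> 0" using IJ y by auto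
  moreover have "(*) y ` I = (*) (a / b * y) ` J"
    unfolding IJ by (simp add: image_image ac_simps)
  ultimately show ?thesis
    using I J y nonzero_idealsD(2)[OF I] nonzero_idealsD(2)[OF J]
    unfolding ideal_class_rel_def by blast
qed

text \<open>A matrix commuting with \<open>C\<close> acts on the eigenline of \<open>C\<close> by a scalar in \<open>\<rat>(l)\<close>, and this
  scalar determines the matrix because the entries of the eigenvector are independent.\<close>

lemma card_commuting_le:
  assumes C: "C \<in> carrier_mat (degree f) (degree f)" "char_poly C = f"
  defines "S \<equiv> {B \<in> carrier_mat (degree f) (degree f). C * B = B * C \<and> char_poly B = f}"
  defines "E \<equiv> {x \<in> rat_adjoin l. poly (map_poly of_int f) x = 0}"
  shows "finite S" and "card S \<le> card E"
proof -
  let ?n = "degree f"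
  obtain v where v: "v \<in> carrier_vec ?n" "v \<noteq> 0\<^sub>v ?n" "map_mat of_int C *\<^sub>v v = l \<cdot>\<^sub>v v"
    and int: "\<And>i. i < ?n \<Longrightarrow> v $ i \<in> int_adjoin l"
    and line: "\<And>x. x \<in> carrier_vec ?n \<Longrightarrow> map_mat of_int C *\<^sub>v x = l \<cdot>\<^sub>v x \<Longrightarrow> \<exists>a. x = a \<cdot>\<^sub>v v"
    and indep: "\<And>c. c \<in> carrier_vec ?n \<Longrightarrow> map_vec of_int c \<bullet> v = 0 \<Longrightarrow> c = 0\<^sub>v ?n"
    using eigenline[OF C] by metis
  from v obtain i where i: "i < ?n" "v $ i \<noteq> 0" by (metis eq_vecI carrier_vecD index_zero_vec)
  have "\<exists>m\<in>E. map_mat of_int B *\<^sub>v v = m \<cdot>\<^sub>v v" if B: "B \<in> S" for B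
  proof -
    have B': "B \<in> carrier_mat ?n ?n" "C * B = B * C" "char_poly B = f"
      using B by (auto simp: S_def)
    have "map_mat of_int C *\<^sub>v (map_mat of_int B *\<^sub>v v) = map_mat of_int (C * B) *\<^sub>v v"
      using C(1) B'(1) v by (simp add: of_int_hom.mat_hom_mult[OF C(1) B'(1)])
    also have "\<dots> = l \<cdot>\<^sub>v (map_mat of_int B *\<^sub>v v)"
      unfolding B'(2) using C(1) B'(1) v
      by (simp add: of_int_hom.mat_hom_mult[OF B'(1) C(1)] mult_mat_vec[of _ ?n ?n])
    finally obtain m where m: "map_mat of_int B *\<^sub>v v = m \<cdot>\<^sub>v v"
      using line[of "map_mat of_int B *\<^sub>v v"] B' v by auto
    have "(map_mat of_int B *\<^sub>v v) $ i = (\<Sum>j<?n. of_int (B $$ (i, j)) * v $ j)"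
      using B' v i by (simp add: scalar_prod_def atLeast0LessThan)
    also have "\<dots> \<in> int_adjoin l" using int by (intro sum_int_adjoin) simp
    finally have "(map_mat of_int B *\<^sub>v v) $ i \<in> rat_adjoin l"
      using int_adjoin_subset_rat_adjoin by blast
    \<comment> \<open>The scalar is a quotient of two elements of \<open>int_adjoin l\<close>, read
      off at a coordinate where \<open>v\<close> does not vanish.\<close>
    moreover have "m = (map_mat of_int B *\<^sub>v v) $ i * inverse (v $ i)"
      unfolding m using i v by simp
    moreover have "v $ i \<in> rat_adjoin l" using int i int_adjoin_subset_rat_adjoin by blast
    ultimately have "m \<in> rat_adjoin l"
      using rat_adjoin_mult rat_adjoin_inverse by metis
    moreover have "eigenvalue (map_mat of_int B) m"
      using B' v m by (auto simp: eigenvalue_def eigenvector_def)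
    then have "poly (map_poly of_int f) m = 0"
      using eigenvalue_root_char_poly[of "map_mat of_int B" ?n m] B'
      by (simp add: of_int_hom.char_poly_hom[OF B'(1)])
    ultimately show ?thesis using m by (auto simp: E_def)
  qed
  then obtain m where m: "\<And>B. B \<in> S \<Longrightarrow> m B \<in> E"
    "\<And>B. B \<in> S \<Longrightarrow> map_mat of_int B *\<^sub>v v = m B \<cdot>\<^sub>v v" by metis
  have inj: "inj_on m S"
  proof (rule inj_onI)
    fix B B' assume B: "B \<in> S" "B' \<in> S" "m B = m B'"
    have c: "B \<in> carrier_mat ?n ?n" "B' \<in> carrier_mat ?n ?n" using B by (auto simp: S_def)
    have eq: "map_mat of_int B *\<^sub>v v = map_mat of_int B' *\<^sub>v v" using m B by simp
    show "B = B'"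
    proof (rule eq_rowI)
      fix k assume "k < dim_row B'"
      then have k: "k < ?n" using c by simp
      \<comment> \<open>Equal scalars make each difference of rows an integer relation among the
        entries of \<open>v\<close>.\<close>
      have "map_vec of_int (row B k - row B' k) \<bullet> v =
          (map_mat of_int B *\<^sub>v v) $ k - (map_mat of_int B' *\<^sub>v v) $ k"
        using k c v by (simp add: scalar_prod_def sum_subtractf algebra_simps)
      then have "row B k - row B' k = 0\<^sub>v ?n"
        using c k by (intro indep) (auto simp: eq intro!: carrier_vecI)
      then show "row B k = row B' k"
        using c by (auto simp: vec_eq_iff)
    qed (use c in auto)
  qed
  have "f \<noteq> 0" using monic by auto
  then have "finite {x. poly (map_poly of_int f :: 'a poly) x = 0}"
    by (intro poly_roots_finite) simp
  then have fin: "finite E" unfolding E_def by (rule rev_finite_subset) auto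
  have "m ` S \<subseteq> E" using m by blast
  then show "finite S" "card S \<le> card E"
    using inj fin card_inj_on_le[OF inj _ fin] finite_subset finite_imageD by blast+
qed

end

section \<open>Conjugate centralizers\<close>

lemma SL_int_subset_GL_int: "SL_int n \<subseteq> GL_int n"
proof
  fix A assume "A \<in> SL_int n"
  then have A: "A \<in> carrier_mat n n" "det A = 1" by (auto simp: SL_int_def)
  then have "A * adj_mat A = 1\<^sub>m n" "adj_mat A * A = 1\<^sub>m n" "adj_mat A \<in> carrier_mat n n"
    using adj_mat[OF A(1)] by auto
  with A show "A \<in> GL_int n"
    by (auto simp: GL_int_def invertible_mat_def inverts_mat_def intro!: exI[of _ "adj_mat A"])
qed

text \<open>Up to the sign \<open>(- 1) ^ n\<close>, the determinant is the value of the
  characteristic polynomial at 0. This puts the matrices built from ideals into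
  \<open>SL_int\<close>.\<close>

lemma det_eq_of_char_poly_eq:
  fixes A B :: "int mat"
  assumes A: "A \<in> carrier_mat n n" and B: "B \<in> carrier_mat n n" and eq: "char_poly A = char_poly B"
  shows "det A = det B"
proof -
  have *: "(- 1) ^ n * of_int (det M) = poly (map_poly rat_of_int (char_poly M)) 0"
    if M: "M \<in> carrier_mat n n" for M :: "int mat"
  proof -
    have M': "map_mat rat_of_int M \<in> carrier_mat n n" using M by simp
    have "- char_matrix (map_mat rat_of_int M) 0 = (- 1) \<cdot>\<^sub>m map_mat rat_of_int M"
      using M by (intro eq_matI) (auto simp: char_matrix_def)
    then show ?thesis
      using char_poly_matrix[OF M', of 0] M'
      by (simp add: of_int_hom.char_poly_hom[OF M] det_smult of_int_hom.hom_det)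
  qed
  have "(- 1) ^ n * of_int (det A) = (- 1) ^ n * (of_int (det B) :: rat)"
    using *[OF A] *[OF B] eq by simp
  then show ?thesis by simp
qed

lemma centralizer_GL_subset: "centralizer_GL n A \<subseteq> carrier_mat n n"
  by (auto simp: centralizer_GL_def GL_int_def)

lemma one_mat_in_GL_int: "1\<^sub>m n \<in> GL_int n"
  by (auto simp: GL_int_def invertible_mat_def inverts_mat_def intro: exI[of _ "1\<^sub>m n"])

lemma conjugate_GL_refl:
  assumes "H \<subseteq> carrier_mat n n"
  shows "conjugate_GL n H H"
proof -
  have "(\<lambda>B. 1\<^sub>m n * B * 1\<^sub>m n) ` H = (\<lambda>B. B) ` H" using assms by (intro image_cong) auto
  then show ?thesis
    unfolding conjugate_GL_def
    by (intro bexI[of _ "1\<^sub>m n"] one_mat_in_GL_int) auto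
qed

lemma conjugate_GL_sym:
  assumes H: "H \<subseteq> carrier_mat n n" and "conjugate_GL n H H'"
  shows "conjugate_GL n H' H"
proof -
  from assms(2) obtain P Q where PQ: "P \<in> GL_int n" "Q \<in> GL_int n" "P * Q = 1\<^sub>m n" "Q * P = 1\<^sub>m n"
    and H': "H' = (\<lambda>B. P * B * Q) ` H" unfolding conjugate_GL_def by blast
  then have P: "P \<in> carrier_mat n n" and Q: "Q \<in> carrier_mat n n" by (auto simp: GL_int_def)
  have "Q * (P * B * Q) * P = B" if "B \<in> H" for B
  proof -
    have B: "B \<in> carrier_mat n n" using H that by blast
    have "Q * (P * B * Q) * P = (Q * P) * B * (Q * P)"
      using P Q B by (simp add: assoc_mult_mat[of _ n n _ n _ n])
    then show ?thesis using B PQ by simp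
  qed
  then have "H = (\<lambda>B. Q * B * P) ` H'" unfolding H' by (force simp: image_image)
  with PQ show ?thesis unfolding conjugate_GL_def by blast
qed

section \<open>Counting ideal classes with conjugate centralizers\<close>

context irreducible_monic_root
begin

text \<open>One ideal is chosen in each class, together with its matrix; conjugate matrices then
  come from the same class.\<close>

lemma class_matrices:
  defines "R \<equiv> int_adjoin l"
  obtains M where "\<And>X. X \<in> nonzero_ideals R // ideal_class_rel R \<Longrightarrow>
      M X \<in> carrier_mat (degree f) (degree f) \<and> char_poly (M X) = f"
    and "\<And>X Y P Q. X \<in> nonzero_ideals R // ideal_class_rel R \<Longrightarrow>
      Y \<in> nonzero_ideals R // ideal_class_rel R \<Longrightarrow>
      P \<in> carrier_mat (degree f) (degree f) \<Longrightarrow> Q \<in> carrier_mat (degree f) (degree f) \<Longrightarrow>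
      Q * P = 1\<^sub>m (degree f) \<Longrightarrow> M Y = P * M X * Q \<Longrightarrow> X = Y"
proof -
  let ?n = "degree f" and ?Cl = "nonzero_ideals R // ideal_class_rel R"
  have equiv: "equiv (nonzero_ideals R) (ideal_class_rel R)"
  proof (rule equiv_ideal_class_rel)
    show "1 \<in> R" using of_int_in_int_adjoin[of 1 l] by (simp add: R_def)
    show "x * y \<in> R" if "x \<in> R" "y \<in> R" for x y
      using generate_ring.eng_mult[of x class_ring "{l}" y] that by (simp add: R_def int_adjoin_def)
  qed
  \<comment> \<open>Bundling the properties lets ideal, matrix and eigenvector be chosen together
    for each class.\<close>
  define good where "good = (\<lambda>X M I v. I \<in> X \<and> I \<in> nonzero_ideals R \<and> M \<in> carrier_mat ?n ?n \<and>
    char_poly M = f \<and> v \<in> carrier_vec ?n \<and> v \<noteq> 0\<^sub>v ?n \<and> map_mat of_int M *\<^sub>v v = l \<cdot>\<^sub>v v \<and>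
    zspan v = I)"
  have "\<exists>M I v. good X M I v" if X: "X \<in> ?Cl" for X
  proof -
    from X obtain I where I: "I \<in> nonzero_ideals R" "I \<in> X"
      using equiv_class_self[OF equiv] by (auto elim!: quotientE)
    then show ?thesis using ideal_matrix[of I] unfolding R_def good_def by metis
  qed
  then obtain M I v where good: "\<And>X. X \<in> ?Cl \<Longrightarrow> good X (M X) (I X) (v X)" by metis
  show ?thesis
  proof
    show "M X \<in> carrier_mat ?n ?n \<and> char_poly (M X) = f" if "X \<in> ?Cl" for X
      using good[OF that] by (simp add: good_def)
    fix X Y P Q assume X: "X \<in> ?Cl" and Y: "Y \<in> ?Cl" and P: "P \<in> carrier_mat ?n ?n"
      "Q \<in> carrier_mat ?n ?n" "Q * P = 1\<^sub>m ?n" "M Y = P * M X * Q"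
    have "(I X, I Y) \<in> ideal_class_rel R"
      using good[OF X] good[OF Y] P unfolding good_def R_def
      by (intro ideal_class_of_conjugate[of _ _ "M X" "v X" "M Y" "v Y" P Q]) auto
    then show "X = Y"
      using quotient_eq_iff[OF equiv X Y] good[OF X] good[OF Y] by (auto simp: good_def)
  qed
qed

text \<open>Each \<open>M X\<close> lies in its own centralizer, so the conjugation of centralizers
  takes it to a matrix commuting with \<open>C\<close>. Distinct classes yield distinct such
  matrices, and there are no more of these than roots of \<open>f\<close> in
  \<open>rat_adjoin l\<close>.\<close>

lemma card_conjugate_centralizers_le:
  assumes M: "\<And>X. X \<in> T \<Longrightarrow> M X \<in> SL_int (degree f) \<and> char_poly (M X) = f"
    and sep: "\<And>X Y P Q. X \<in> T \<Longrightarrow> Y \<in> T \<Longrightarrow> P \<in> carrier_mat (degree f) (degree f) \<Longrightarrow>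
      Q \<in> carrier_mat (degree f) (degree f) \<Longrightarrow> Q * P = 1\<^sub>m (degree f) \<Longrightarrow> M Y = P * M X * Q \<Longrightarrow> X = Y"
    and C: "C \<in> SL_int (degree f)" "char_poly C = f"
    and conj: "\<And>X. X \<in> T \<Longrightarrow>
      conjugate_GL (degree f) (centralizer_GL (degree f) (M X)) (centralizer_GL (degree f) C)"
  shows "card T \<le> card {x \<in> rat_adjoin l. poly (map_poly of_int f) x = 0}"
proof -
  let ?n = "degree f"
  let ?S = "{B \<in> carrier_mat ?n ?n. C * B = B * C \<and> char_poly B = f}"
  have C': "C \<in> carrier_mat ?n ?n" using C by (simp add: SL_int_def)
  have Mc: "M X \<in> carrier_mat ?n ?n" if "X \<in> T" for X using M[OF that] by (simp add: SL_int_def)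
  define ok where "ok = (\<lambda>X P Q. P \<in> carrier_mat ?n ?n \<and> Q \<in> carrier_mat ?n ?n \<and>
    P * Q = 1\<^sub>m ?n \<and> Q * P = 1\<^sub>m ?n \<and> P * M X * Q \<in> ?S)"
  have "\<exists>P Q. ok X P Q" if X: "X \<in> T" for X
  proof -
    from conj[OF X] obtain P Q where P: "P \<in> GL_int ?n" "Q \<in> GL_int ?n" "P * Q = 1\<^sub>m ?n"
      "Q * P = 1\<^sub>m ?n"
      and img: "centralizer_GL ?n C = (\<lambda>B. P * B * Q) ` centralizer_GL ?n (M X)"
      unfolding conjugate_GL_def by blast
    have c: "P \<in> carrier_mat ?n ?n" "Q \<in> carrier_mat ?n ?n" using P by (auto simp: GL_int_def)
    have "M X \<in> centralizer_GL ?n (M X)"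
      using M[OF X] SL_int_subset_GL_int by (auto simp: centralizer_GL_def)
    then have "P * M X * Q \<in> centralizer_GL ?n C" using img by blast
    moreover have "similar_mat (P * M X * Q) (M X)"
      using c P Mc[OF X] by (intro similar_matI[of _ _ P Q ?n]) auto
    then have "char_poly (P * M X * Q) = f" using char_poly_similar M[OF X] by metis
    ultimately show ?thesis using c P by (auto simp: ok_def centralizer_GL_def GL_int_def)
  qed
  then obtain P Q where ok: "\<And>X. X \<in> T \<Longrightarrow> ok X (P X) (Q X)" by metis
  have P: "P X \<in> carrier_mat ?n ?n" and Q: "Q X \<in> carrier_mat ?n ?n" and PQ: "P X * Q X = 1\<^sub>m ?n"
    and QP: "Q X * P X = 1\<^sub>m ?n" and in_S: "P X * M X * Q X \<in> ?S" if "X \<in> T" for X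
    using ok[OF that] unfolding ok_def by blast+
  have "inj_on (\<lambda>X. P X * M X * Q X) T"
  proof (rule inj_onI)
    fix X Y assume X: "X \<in> T" and Y: "Y \<in> T" and eq: "P X * M X * Q X = P Y * M Y * Q Y"
    note c = P[OF X] P[OF Y] Q[OF X] Q[OF Y] Mc[OF X] Mc[OF Y]
    note assoc = assoc_mult_mat[of _ ?n ?n _ ?n _ ?n]
    \<comment> \<open>If the two images agree, \<open>Q Y * P X\<close> conjugates
      \<open>M X\<close> to \<open>M Y\<close>, with inverse \<open>Q X * P Y\<close>; then
      \<open>sep\<close> applies.\<close>
    have "M Y = (Q Y * P Y) * M Y * (Q Y * P Y)" using c QP[OF Y] by simp
    also have "\<dots> = Q Y * (P Y * M Y * Q Y) * P Y" using c by (simp add: assoc)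
    also have "\<dots> = (Q Y * P X) * M X * (Q X * P Y)"
      unfolding eq[symmetric] using c by (simp add: assoc)
    finally have "M Y = (Q Y * P X) * M X * (Q X * P Y)" .
    moreover have "(Q X * P Y) * (Q Y * P X) = Q X * (P Y * Q Y) * P X" using c by (simp add: assoc)
    then have "(Q X * P Y) * (Q Y * P X) = 1\<^sub>m ?n" using c PQ[OF Y] QP[OF X] by simp
    ultimately show "X = Y"
      using sep[OF X Y mult_carrier_mat[OF c(4,1)] mult_carrier_mat[OF c(3,2)]] by blast
  qed
  moreover have "(\<lambda>X. P X * M X * Q X) ` T \<subseteq> ?S"
    by (intro image_subsetI in_S)
  ultimately have "card T \<le> card ?S"
    by (rule card_inj_on_le) (rule card_commuting_le(1)[OF C' C(2)])
  then show ?thesis using card_commuting_le(2)[OF C' C(2)] by (rule order_trans)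
qed

end

section \<open>Maximal families and the final count\<close>

text \<open>An element outside a family that is maximal under inclusion must clash with a member.
  Both directions of \<open>R\<close> occur in the conclusion because \<open>R\<close> is an
  arbitrary relation.\<close>

lemma ex_maximal_pairwise:
  assumes "finite T"
  obtains S where "S \<subseteq> T" and "pairwise R S"
    and "\<And>x. x \<in> T \<Longrightarrow> x \<in> S \<or> (\<exists>y\<in>S. \<not> R x y \<or> \<not> R y x)"
proof -
  define F where "F = {S. S \<subseteq> T \<and> pairwise R S}"
  have "finite F" using assms by (simp add: F_def)
  moreover have "{} \<in> F" by (simp add: F_def)
  ultimately obtain S where S: "S \<in> F" and max: "\<And>S'. S' \<in> F \<Longrightarrow> S \<subseteq> S' \<Longrightarrow> S = S'"
    using finite_has_maximal[of F] by (metis empty_iff)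
  have "x \<in> S \<or> (\<exists>y\<in>S. \<not> R x y \<or> \<not> R y x)" if "x \<in> T" for x
    using max[of "insert x S"] S that by (auto simp: F_def pairwise_insert)
  with S show ?thesis using that unfolding F_def by blast
qed

theorem theorem4p5:
  fixes n r :: nat and A :: "int mat" and lam :: "nat \<Rightarrow> real" and l :: real and K :: "real set"
  assumes A_SL: "A \<in> SL_int n"
    and hyp: "hyperbolic_mat A"
    and irred: "irreducible (map_poly rat_of_int (char_poly A))"
    and distinct: "inj_on lam {1..n}"
    and eigenvalues: "{x. eigenvalue (map_mat real_of_int A) x} = lam ` {1..n}"
    and l_eigenvalue: "eigenvalue (map_mat real_of_int A) l"
    and K_def: "K = rat_adjoin l"
    and integers: "ring_of_integers K = int_adjoin l"
    and r_def: "r = card {i \<in> {1..n}. lam i \<in> K}"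
  shows "(class_number K > r \<longrightarrow>
            (\<exists>A' \<in> SL_int n. char_poly A' = char_poly A \<and>
               \<not> conjugate_GL n (centralizer_GL n A') (centralizer_GL n A))) \<and>
         (\<exists>S. S \<subseteq> SL_int n \<and> finite S \<and> (\<forall>B \<in> S. char_poly B = char_poly A) \<and>
            pairwise (\<lambda>B C. \<not> conjugate_GL n (centralizer_GL n B) (centralizer_GL n C)) S \<and>
            int (card S) \<ge> strict_floor (real (class_number K) / real r) + 1)"
proof -
  define f where "f = char_poly A"
  define Cl where "Cl = nonzero_ideals (int_adjoin l) // ideal_class_rel (int_adjoin l)"
  let ?conj = "\<lambda>B C. conjugate_GL n (centralizer_GL n B) (centralizer_GL n C)"
  have A: "A \<in> carrier_mat n n" "det A = 1" using A_SL by (auto simp: SL_int_def)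
  have f: "degree f = n" "lead_coeff f = 1"
    using degree_monic_char_poly[OF A(1)] by (auto simp: f_def)
  have root_iff: "poly (map_poly of_int f) x = 0 \<longleftrightarrow> eigenvalue (map_mat of_int A) x" for x :: real
    using eigenvalue_root_char_poly[of "map_mat of_int A" n x] A
    by (simp add: of_int_hom.char_poly_hom[OF A(1)] f_def)
  interpret irreducible_monic_root f l
    by unfold_locales (use irred f l_eigenvalue root_iff in \<open>auto simp: f_def\<close>)
  have "eigenvalue (map_mat real_of_int A) x \<longleftrightarrow> x \<in> lam ` {1..n}" for x using eigenvalues by blast
  \<comment> \<open>The roots of \<open>f\<close> in \<open>K\<close> are exactly the listed
    eigenvalues in \<open>K\<close>; injectivity of \<open>lam\<close> then makes their number
    \<open>r\<close>.\<close>
  then have "{x \<in> rat_adjoin l. poly (map_poly of_int f) x = 0} = lam ` {i \<in> {1..n}. lam i \<in> K}"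
    by (auto simp: root_iff K_def)
  then have r: "card {x \<in> rat_adjoin l. poly (map_poly of_int f) x = 0} = r"
    using card_image[OF inj_on_subset[OF distinct Collect_restrict]] by (simp only: r_def)
  have h: "class_number K = card Cl" by (simp add: class_number_def integers Cl_def)
  obtain M where M: "\<And>X. X \<in> Cl \<Longrightarrow> M X \<in> carrier_mat n n \<and> char_poly (M X) = f"
    and sep: "\<And>X Y P Q. X \<in> Cl \<Longrightarrow> Y \<in> Cl \<Longrightarrow> P \<in> carrier_mat n n \<Longrightarrow> Q \<in> carrier_mat n n \<Longrightarrow>
      Q * P = 1\<^sub>m n \<Longrightarrow> M Y = P * M X * Q \<Longrightarrow> X = Y"
    using class_matrices unfolding Cl_def f(1) by metis
  have M_SL: "M X \<in> SL_int n" if "X \<in> Cl" for X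
    using M[OF that] det_eq_of_char_poly_eq[of "M X" n A] A by (auto simp: SL_int_def f_def)
  have bound: "card {X \<in> Cl. ?conj (M X) C} \<le> r" if "C \<in> SL_int n" "char_poly C = f" for C
    unfolding r[symmetric]
    by (rule card_conjugate_centralizers_le[of _ M C]) (use M M_SL sep that in \<open>auto simp: f(1)\<close>)
  have "\<exists>A' \<in> SL_int n. char_poly A' = f \<and> \<not> ?conj A' A" if "class_number K > r"
  proof (rule ccontr)
    assume "\<not> ?thesis"
    \<comment> \<open>If all centralizers were conjugate to that of \<open>A\<close>, then
      \<open>bound\<close> would limit the whole class number by \<open>r\<close>.\<close>
    then have "{X \<in> Cl. ?conj (M X) A} = Cl" using M M_SL by auto
    with bound[OF A_SL] h that show False by (simp add: f_def)
  qed
  moreover have "\<exists>S. S \<subseteq> SL_int n \<and> finite S \<and> (\<forall>B \<in> S. char_poly B = f) \<and>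
      pairwise (\<lambda>B C. \<not> ?conj B C) S \<and>
      int (card S) \<ge> strict_floor (real (class_number K) / real r) + 1"
  proof (cases "finite Cl")
    case False
    \<comment> \<open>An infinite set has \<open>card\<close> 0, so the required bound is
      \<open>strict_floor 0 + 1\<close>, which is 0.\<close>
    then show ?thesis by (intro exI[of _ "{}"]) (simp add: h strict_floor_eq)
  next
    case True
    obtain S where S: "S \<subseteq> M ` Cl" "pairwise (\<lambda>B C. \<not> ?conj B C) S"
      and max: "\<And>B. B \<in> M ` Cl \<Longrightarrow> B \<in> S \<or> (\<exists>C\<in>S. ?conj B C \<or> ?conj C B)"
      using ex_maximal_pairwise[of "M ` Cl" "\<lambda>B C. \<not> ?conj B C"] True by auto
    have fin: "finite S" using S(1) True by (meson finite_imageI finite_subset)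
    have S': "S \<subseteq> SL_int n" "\<forall>B\<in>S. char_poly B = f" using S(1) M M_SL by auto
    \<comment> \<open>By maximality every class is attached to some member of \<open>S\<close>, and
      each member accounts for at most \<open>r\<close> classes.\<close>
    have "Cl \<subseteq> (\<Union>C\<in>S. {X \<in> Cl. ?conj (M X) C})"
    proof
      fix X assume X: "X \<in> Cl"
      then consider "M X \<in> S" | C where "C \<in> S" "?conj (M X) C \<or> ?conj C (M X)"
        using max[of "M X"] by blast
      then have "\<exists>C\<in>S. ?conj (M X) C"
      proof cases
        case 1
        then show ?thesis using conjugate_GL_refl[OF centralizer_GL_subset] by metis
      next
        case 2
        then show ?thesis using conjugate_GL_sym[OF centralizer_GL_subset] by metis
      qed
      with X show "X \<in> (\<Union>C\<in>S. {X \<in> Cl. ?conj (M X) C})" by blast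
    qed
    then have "card Cl \<le> card (\<Union>C\<in>S. {X \<in> Cl. ?conj (M X) C})"
      by (intro card_mono) (use fin True in auto)
    also have "\<dots> \<le> (\<Sum>C\<in>S. card {X \<in> Cl. ?conj (M X) C})" by (rule card_UN_le[OF fin])
    also have "\<dots> \<le> (\<Sum>C\<in>S. r)" by (intro sum_mono bound) (use S' in auto)
    finally have "card Cl \<le> card S * r" by simp
    then have "real (card Cl) \<le> real (card S) * real r" by (metis of_nat_le_iff of_nat_mult)
    \<comment> \<open>For \<open>r = 0\<close> the quotient is 0 by convention.\<close>
    then have "real (card Cl) / real r \<le> real (card S)"
      by (cases "r = 0") (simp_all add: divide_le_eq)
    \<comment> \<open>The strict floor plus one is the ceiling, which is at most
      \<open>card S\<close> as soon as its argument is.\<close>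
    then have "strict_floor (real (class_number K) / real r) + 1 \<le> int (card S)"
      by (simp add: strict_floor_eq h ceiling_le_iff)
    with S S' fin show ?thesis by blast
  qed
  ultimately show ?thesis by (simp add: f_def)
qed

end
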